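(* Let $\mathbb{K}\in\{\mathbb{R},\mathbb{C}\}$, let $X$ be a normed space over $\mathbb{K}$, and let $Y_\rho$ be the modular space of a convex modular $\rho$ satisfying the $\Delta_2$-condition. Let $E$ be a non-empty subset of $X$ that is symmetric with respect to $0$ and satisfies $x+y,\ x-y\in E$ and $kx\in E$ for all $x,y\in E$ and all $k\in\mathbb{K}$. Let $a,b\in\mathbb{K}\setminus\{0\}$ and let $\alpha:E^2\to[0,\infty)$ be a function such that $$\lim_{n\to\infty}\alpha\big(a^{-1}(n+1)x,-b^{-1}nx\big)=0\quad\text{and}\quad\lim_{n\to\infty}\alpha(nx,ny)=0\qquad\text{for all }x,y\in E\setminus\{0\}.$$ Let $A,B\in\mathbb{R}$ with $|A|\le1$ and $|B|\le1$, let $C\in Y_\rho$, and let $\varphi:X\to Y_\rho$ be a mapping such that, for some real number $d>0$, $$\rho\big(\varphi(ax+by)-A\varphi(x)-B\varphi(y)-C\big)\le\alpha(x,y)\qquad\text{for all }x,y\in M_d:=\{z\in E:\|z\|\ge d\}.$$ Then $$\varphi(ax+by)=A\varphi(x)+B\varphi(y)+C\quad\text{and}\quad (A+B)\varphi(0)=A\varphi(x)+B\varphi(-ab^{-1}x)\qquad\text{for all }x,y\in E.$$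
   Context: Let $Y$ be a (real or complex) vector space. A convex modular on $Y$ is a functional $\rho:Y\to[0,\infty)$ such that for all $u,v\in Y$: (1) $\rho(u)=0$ if and only if $u=0$; (2) $\rho(cu)=\rho(u)$ for every scalar $c$ with $|c|=1$; (3) $\rho(su+tv)\le s\rho(u)+t\rho(v)$ whenever $s,t\ge0$ and $s+t=1$. The associated modular space is $Y_\rho=\{u\in Y:\rho(\lambda u)\to0\text{ as }\lambda\to0\}$. The modular satisfies the $\Delta_2$-condition if there exists $\tau>0$ such that $\rho(2u)\le\tau\rho(u)$ for all $u\in Y_\rho$. Limits in $n$ are over positive integers $n$.
   Formalization: The set E is additionally assumed to be different from {0}; for E = {0} the conditions on α and φ are vacuous and the claim fails (e.g. A = B = 0, C = 0, φ a nonzero constant). *)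

theory Defs
  imports Complex_Main
begin

(* The scalar field is a type 'k of class real_normed_field. Both real and complex are
   instances, and by the Gelfand-Mazur theorem they are, up to isometric isomorphism, the
   only models of this class; 'k thus plays the role of "K = R or K = C". *)

(* The type 'a carries its norm and its real scalar multiplication from real_normed_vector;
   scale extends the latter to the field 'k (for 'k = real it coincides with scaleR). *)
locale normed_space_over = vector_space scale
  for scale :: "'k::real_normed_field \<Rightarrow> 'a::real_normed_vector \<Rightarrow> 'a" +
  assumes scale_of_real: "scale (of_real r) x = r *\<^sub>R x"
    and norm_scale: "norm (scale k x) = norm k * norm x"

locale convex_modular = vector_space scale
  for scale :: "'k::real_normed_field \<Rightarrow> 'b::ab_group_add \<Rightarrow> 'b" +
  fixes \<rho> :: "'b \<Rightarrow> real"
  assumes modular_nonneg: "\<rho> u \<ge> 0"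
    and modular_eq_0_iff: "\<rho> u = 0 \<longleftrightarrow> u = 0"
    and modular_scale_unit: "norm c = 1 \<Longrightarrow> \<rho> (scale c u) = \<rho> u"
    and modular_convex: "s \<ge> 0 \<Longrightarrow> t \<ge> 0 \<Longrightarrow> s + t = 1 \<Longrightarrow>
      \<rho> (scale (of_real s) u + scale (of_real t) v) \<le> s * \<rho> u + t * \<rho> v"

definition modular_space ::
    "('k::real_normed_field \<Rightarrow> 'b::ab_group_add \<Rightarrow> 'b) \<Rightarrow> ('b \<Rightarrow> real) \<Rightarrow> 'b set" where
  "modular_space scale \<rho> = {u. ((\<lambda>c. \<rho> (scale c u)) \<longlongrightarrow> 0) (at 0)}"

definition Delta2_condition ::
    "('k::real_normed_field \<Rightarrow> 'b::ab_group_add \<Rightarrow> 'b) \<Rightarrow> ('b \<Rightarrow> real) \<Rightarrow> bool" where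
  "Delta2_condition scale \<rho> \<longleftrightarrow>
    (\<exists>\<tau>>0. \<forall>u\<in>modular_space scale \<rho>. \<rho> (scale 2 u) \<le> \<tau> * \<rho> u)"

end

theory Submission imports Defs
begin

text \<open>
  Let \<open>R x y\<close> denote the defect \<open>\<phi> (a x + b y) - A \<phi> x - B \<phi> y - C\<close>. For \<open>z \<noteq> 0\<close> the defects
  \<open>S n z = R (a\<^sup>-\<^sup>1 (n + 1) z) (- b\<^sup>-\<^sup>1 n z)\<close> express \<open>\<phi> z\<close> through values of \<open>\<phi>\<close> far from the origin,
  and they tend to 0. Substituting these expressions for \<open>\<phi> (a x + b y)\<close>, \<open>\<phi> x\<close> and \<open>\<phi> y\<close> gives
  \<open>R x y = A R (a\<^sup>-\<^sup>1 (n + 1) x) (a\<^sup>-\<^sup>1 (n + 1) y) + B R (- b\<^sup>-\<^sup>1 n x) (- b\<^sup>-\<^sup>1 n y)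
    + S n (a x + b y) - A S n x - B S n y\<close>,
  whose right-hand side tends to 0, so \<open>R x y = 0\<close> whenever \<open>x\<close>, \<open>y\<close> and \<open>a x + b y\<close> are nonzero.
  The remaining cases involve \<open>\<phi> 0\<close> and are algebraic: on the punctured subspace the equation
  is of Pexider type \<open>P u + Q v = f (u + v)\<close>. It makes \<open>P u + Q (- u)\<close> constant, the
  limit of \<open>R (n x) (- n a b\<^sup>-\<^sup>1 x)\<close> identifies the constant with \<open>f 0\<close>, and \<open>f\<close> is then affine.
\<close>

section \<open>Pexider equations on a subspace without its origin\<close>

text \<open>With \<open>w = u + u' + v\<close>, the sums \<open>u + v = w - u'\<close> and
  \<open>u' + v = w - u\<close> give
  \<open>P u + Q (- u) = f (u + v) + f (u' + v) - Q v - P w\<close>, which is symmetric in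
  \<open>u\<close> and \<open>u'\<close>.\<close>

lemma pexider_diagonal_constant:
  fixes E :: "'a::real_vector set" and f P Q :: "'a \<Rightarrow> 'b::ab_group_add"
  assumes "subspace E"
    and eq: "\<And>u v. \<lbrakk>u \<in> E; v \<in> E; u \<noteq> 0; v \<noteq> 0; u + v \<noteq> 0\<rbrakk> \<Longrightarrow> P u + Q v = f (u + v)"
    and u: "u \<in> E" "u \<noteq> 0" and u': "u' \<in> E" "u' \<noteq> 0"
  shows "P u + Q (- u) = P u' + Q (- u')"
proof -
  have neq: "r *\<^sub>R u \<noteq> s *\<^sub>R u" if "r \<noteq> s" for r s
    using that u(2) by simp
  \<comment> \<open>For \<open>v = k *\<^sub>R u\<close>, positivity gives
    \<open>v \<noteq> 0\<close> and \<open>u + v \<noteq> 0\<close>; the other two conditions give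
    \<open>u' + v \<noteq> 0\<close> and \<open>w \<noteq> 0\<close>. If \<open>k = 1\<close> fails,
    then \<open>u'\<close> is \<open>- u\<close> or \<open>-2 *\<^sub>R u\<close>, and
    \<open>k = 3\<close> works.\<close>
  have "\<exists>k::real. k > 0 \<and> u' \<noteq> (- k) *\<^sub>R u \<and> u' \<noteq> (- (k + 1)) *\<^sub>R u"
  proof (cases "u' = (-1) *\<^sub>R u \<or> u' = (-2) *\<^sub>R u")
    case True
    then show ?thesis
      using neq[of "-1" "-3"] neq[of "-1" "-4"] neq[of "-2" "-3"] neq[of "-2" "-4"]
      by (intro exI[of _ 3]) auto
  next
    case False
    then show ?thesis by (intro exI[of _ 1]) auto
  qed
  then obtain k :: real where k: "k > 0" "u' \<noteq> (- k) *\<^sub>R u" "u' \<noteq> (- (k + 1)) *\<^sub>R u"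
    by blast
  define v where "v = k *\<^sub>R u"
  define w where "w = u + u' + v"
  have mem: "v \<in> E" "w \<in> E" "- u \<in> E" "- u' \<in> E"
    unfolding w_def v_def using assms by (auto intro: subspace_add subspace_scale subspace_neg)
  have "u + v = (k + 1) *\<^sub>R u" by (simp add: v_def algebra_simps)
  then have nz: "v \<noteq> 0" "u + v \<noteq> 0" using k u by (auto simp: v_def)
  have "u' + v \<noteq> 0" using k(2) by (auto simp: v_def eq_neg_iff_add_eq_0)
  moreover have "w \<noteq> 0" using k(3) by (auto simp: w_def v_def eq_neg_iff_add_eq_0 algebra_simps)
  moreover have "w - u' = u + v" "w - u = u' + v" by (simp_all add: w_def algebra_simps)
  ultimately have *: "P u = f (u + v) - Q v" "P u' = f (u' + v) - Q v"
    "Q (- u') = f (u + v) - P w" "Q (- u) = f (u' + v) - P w"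
    using eq[of u v] eq[of u' v] eq[of w "- u'"] eq[of w "- u"] u u' mem nz
    by (simp_all add: eq_diff_eq add.commute)
  show ?thesis unfolding * by (simp add: algebra_simps)
qed

text \<open>Splitting \<open>u\<close> and \<open>u + v\<close> with the common summand
  \<open>u - v\<close> shows that \<open>f (u + v) - f u = Q (2 *\<^sub>R v) - Q v\<close> does not
  depend on \<open>u\<close>, while \<open>P u - P u' = f (u + v) - f (u' + v)\<close>.\<close>

lemma pexider_difference:
  fixes E :: "'a::real_vector set" and f P Q :: "'a \<Rightarrow> 'b::ab_group_add"
  assumes "subspace E"
    and eq: "\<And>u v. \<lbrakk>u \<in> E; v \<in> E; u \<noteq> 0; v \<noteq> 0\<rbrakk> \<Longrightarrow> P u + Q v = f (u + v)"
    and u: "u \<in> E" "u \<noteq> 0" and u': "u' \<in> E" "u' \<noteq> 0"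
  shows "P u - P u' = f u - f u'"
proof -
  \<comment> \<open>Avoiding \<open>u\<close> and \<open>u'\<close> keeps the summands
    \<open>u - v\<close> and \<open>u' - v\<close> nonzero.\<close>
  have "\<exists>v\<in>E. v \<noteq> 0 \<and> v \<noteq> u \<and> v \<noteq> u'"
  proof (cases "u' = 2 *\<^sub>R u")
    case True
    then show ?thesis using u assms(1) scaleR_cancel_right[of 3 u 1]
      by (intro bexI[of _ "3 *\<^sub>R u"]) (auto intro: subspace_scale)
  next
    case False
    then show ?thesis using u assms(1) scaleR_cancel_right[of 2 u 1]
      by (intro bexI[of _ "2 *\<^sub>R u"]) (auto intro: subspace_scale)
  qed
  then obtain v where v: "v \<in> E" "v \<noteq> 0" "v \<noteq> u" "v \<noteq> u'" by blast
  have mem: "2 *\<^sub>R v \<in> E" "u - v \<in> E" "u' - v \<in> E"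
    using assms v by (auto intro: subspace_scale subspace_diff)
  have dv: "u - v + 2 *\<^sub>R v = u + v" "u' - v + 2 *\<^sub>R v = u' + v"
    by (simp_all add: scaleR_2)
  have "P u = f (u + v) - Q v" "P u' = f (u' + v) - Q v"
    "f u = P (u - v) + Q v" "f u' = P (u' - v) + Q v"
    "f (u + v) = P (u - v) + Q (2 *\<^sub>R v)" "f (u' + v) = P (u' - v) + Q (2 *\<^sub>R v)"
    using eq[of u v] eq[of u' v] eq[of "u - v" v] eq[of "u' - v" v]
      eq[of "u - v" "2 *\<^sub>R v"] eq[of "u' - v" "2 *\<^sub>R v"] u u' v mem dv
    by (simp_all add: eq_diff_eq)
  then show ?thesis by simp
qed

text \<open>Both \<open>P - f\<close> and \<open>Q - f\<close> are constant away from 0 by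
  \<open>pexider_difference\<close>. The doubling rule relates these constants to
  \<open>f 0\<close>, and later determines \<open>K\<close>.\<close>

lemma pexider_affine:
  fixes E :: "'a::real_vector set" and f P Q :: "'a \<Rightarrow> 'b::ab_group_add"
  assumes "subspace E" "E \<noteq> {0}"
    and eq: "\<And>u v. \<lbrakk>u \<in> E; v \<in> E; u \<noteq> 0; v \<noteq> 0\<rbrakk> \<Longrightarrow> P u + Q v = f (u + v)"
  obtains K where "\<And>u. \<lbrakk>u \<in> E; u \<noteq> 0\<rbrakk> \<Longrightarrow> P u = f u - K"
    "\<And>u. \<lbrakk>u \<in> E; u \<noteq> 0\<rbrakk> \<Longrightarrow> Q u = f u - (f 0 - K)"
    "\<And>u. \<lbrakk>u \<in> E; u \<noteq> 0\<rbrakk> \<Longrightarrow> f (2 *\<^sub>R u) = f u + f u - f 0"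
proof -
  obtain e where e: "e \<in> E" "e \<noteq> 0"
    using assms(1,2) subspace_0 by blast
  have dP: "P u - P u' = f u - f u'" if "u \<in> E" "u \<noteq> 0" "u' \<in> E" "u' \<noteq> 0" for u u'
    using pexider_difference[of E P Q f u u'] assms(1) eq that by auto
  have dQ: "Q u - Q u' = f u - f u'" if "u \<in> E" "u \<noteq> 0" "u' \<in> E" "u' \<noteq> 0" for u u'
    using pexider_difference[of E Q P f u u'] assms(1) eq that by (auto simp: add.commute)
  have double: "f (2 *\<^sub>R u) = f u + f u - f 0" if u: "u \<in> E" "u \<noteq> 0" for u
  proof -
    have mem: "2 *\<^sub>R u \<in> E" "- u \<in> E"
      using assms(1) u by (auto intro: subspace_scale subspace_neg)
    have "2 *\<^sub>R u + - u = u" by (simp add: scaleR_2)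
    \<comment> \<open>Subtracting these two splittings, of \<open>u\<close> and of 0, cancels
      \<open>Q (- u)\<close>.\<close>
    then have "P (2 *\<^sub>R u) + Q (- u) = f u" "P u + Q (- u) = f 0"
      using eq[of "2 *\<^sub>R u" "- u"] eq[of u "- u"] u mem by auto
    then have "f u - f 0 = P (2 *\<^sub>R u) - P u" by (metis add_diff_cancel_right)
    also have "\<dots> = f (2 *\<^sub>R u) - f u" using dP u mem by auto
    finally show ?thesis by (simp add: algebra_simps)
  qed
  show thesis
  proof (rule that[of "f e - P e"])
    show "P u = f u - (f e - P e)" if "u \<in> E" "u \<noteq> 0" for u
      using dP[OF that e] by (simp add: algebra_simps)
    show "Q u = f u - (f 0 - (f e - P e))" if "u \<in> E" "u \<noteq> 0" for u
    proof -
      have Qu: "Q u = Q e + (f u - f e)" using dQ[OF that e] by (simp add: algebra_simps)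
      have Qe: "Q e = f e + f e - f 0 - P e"
        using double[OF e] eq[OF e(1) e(1) e(2) e(2)] by (simp add: eq_diff_eq scaleR_2 add.commute)
      show ?thesis unfolding Qu Qe by simp
    qed
  qed (use double in auto)
qed

text \<open>Makes the Pexider lemmas, which use real scalars only, available for subspaces over
  \<open>'k\<close>.\<close>

lemma real_subspace:
  assumes "normed_space_over s" "module.subspace s E"
  shows "subspace E"
proof -
  interpret X: normed_space_over s by fact
  show ?thesis
    using assms(2) unfolding subspace_def X.subspace_def X.scale_of_real[symmetric] by blast
qed

text \<open>Applying \<open>g\<close> and \<open>h\<close> to the doubling rule for \<phi> yields
  doubling rules for \<open>P\<close> and \<open>Q\<close>. Each of them determines
  \<open>K\<close>, and \<open>K\<close> supplies the missing equations with a zero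
  argument.\<close>

lemma affine_equation_extend:
  fixes sX :: "'k::real_normed_field \<Rightarrow> 'x::real_normed_vector \<Rightarrow> 'x"
    and g h :: "'y::ab_group_add \<Rightarrow> 'y" and \<phi> :: "'x \<Rightarrow> 'y"
  assumes X: "normed_space_over sX" and E: "module.subspace sX E" "E \<noteq> {0}"
    and gh: "additive g" "additive h" and ab: "a \<noteq> 0" "b \<noteq> 0"
    and eq: "\<And>x y. \<lbrakk>x \<in> E; y \<in> E; x \<noteq> 0; y \<noteq> 0\<rbrakk> \<Longrightarrow>
      \<phi> (sX a x + sX b y) = g (\<phi> x) + h (\<phi> y) + C"
    and xy: "x \<in> E" "y \<in> E"
  shows "\<phi> (sX a x + sX b y) = g (\<phi> x) + h (\<phi> y) + C"
proof -
  interpret X: normed_space_over sX by fact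
  interpret g: additive g by fact
  interpret h: additive h by fact
  have sub: "subspace E" by (rule real_subspace[OF X E(1)])
  define P where "P u = g (\<phi> (sX (inverse a) u)) + C" for u
  define Q where "Q u = h (\<phi> (sX (inverse b) u))" for u
  have closed: "sX k u \<in> E" if "u \<in> E" for k u
    using E(1) that by (rule X.subspace_scale)
  have inv: "sX a (sX (inverse a) u) = u" "sX b (sX (inverse b) u) = u"
    "sX (inverse a) (sX a u) = u" "sX (inverse b) (sX b u) = u" for u
    using ab by simp_all
  have pex: "P u + Q v = \<phi> (u + v)" if "u \<in> E" "v \<in> E" "u \<noteq> 0" "v \<noteq> 0" for u v
    using eq[of "sX (inverse a) u" "sX (inverse b) v"] that ab closed inv
    by (simp add: P_def Q_def algebra_simps)
  obtain K where P: "\<And>u. \<lbrakk>u \<in> E; u \<noteq> 0\<rbrakk> \<Longrightarrow> P u = \<phi> u - K"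
    and Q: "\<And>u. \<lbrakk>u \<in> E; u \<noteq> 0\<rbrakk> \<Longrightarrow> Q u = \<phi> u - (\<phi> 0 - K)"
    and double: "\<And>u. \<lbrakk>u \<in> E; u \<noteq> 0\<rbrakk> \<Longrightarrow> \<phi> (2 *\<^sub>R u) = \<phi> u + \<phi> u - \<phi> 0"
    using pexider_affine[OF sub E(2), of P Q \<phi>] pex by blast
  obtain e where e: "e \<in> E" "e \<noteq> 0"
    using E sub subspace_0 by blast
  have e2: "2 *\<^sub>R e \<in> E" "2 *\<^sub>R e \<noteq> 0"
    using e sub by (auto intro: subspace_scale)
  have comm: "sX k (2 *\<^sub>R e) = 2 *\<^sub>R sX k e" for k
    by (simp add: X.scale_of_real[symmetric] X.scale_left_commute)
  have "P (2 *\<^sub>R e) = P e + P e - g (\<phi> 0) - C"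
    using arg_cong[OF double[of "sX (inverse a) e"], of g] e ab closed
    by (simp add: P_def comm g.add g.diff)
  then have K: "K = \<phi> 0 - g (\<phi> 0) - C"
    using P[OF e] P[OF e2] double[OF e] by (simp add: algebra_simps)
  have "Q (2 *\<^sub>R e) = Q e + Q e - h (\<phi> 0)"
    using arg_cong[OF double[of "sX (inverse b) e"], of h] e ab closed
    by (simp add: Q_def comm h.add h.diff)
  then have K': "K = h (\<phi> 0)"
    using Q[OF e] Q[OF e2] double[OF e] by (simp add: algebra_simps)
  have "\<phi> (sX a x) = g (\<phi> x) + h (\<phi> 0) + C" if "x \<noteq> 0"
    using P[of "sX a x"] that xy ab closed K' by (simp add: P_def inv algebra_simps)
  moreover have "\<phi> (sX b y) = g (\<phi> 0) + h (\<phi> y) + C" if "y \<noteq> 0"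
    using Q[of "sX b y"] that xy ab closed K by (simp add: Q_def inv algebra_simps)
  \<comment> \<open>Equating the two values of \<open>K\<close> is the equation at the
    origin.\<close>
  moreover have "\<phi> 0 = g (\<phi> 0) + h (\<phi> 0) + C"
    using K K' by (simp add: algebra_simps)
  ultimately show ?thesis using eq[of x y] xy by (cases "x = 0"; cases "y = 0") auto
qed

section \<open>Modular spaces and sequences whose modular tends to 0\<close>

context convex_modular
begin

lemma modular_0 [simp]: "\<rho> 0 = 0"
  by (simp add: modular_eq_0_iff)

lemma modular_tendsto_0:
  assumes "\<forall>\<^sub>F n in F. \<rho> (f n) \<le> g n" "(g \<longlongrightarrow> 0) F"
  shows "((\<lambda>n. \<rho> (f n)) \<longlongrightarrow> 0) F"
  by (rule tendsto_sandwich[of "\<lambda>_. 0" _ _ g]) (use assms modular_nonneg in auto)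

text \<open>The unit scalar -1 removes the sign of \<open>r\<close>; convexity is then used against
  the vector 0 with weight \<open>1 - \<bar>r\<bar>\<close>.\<close>

lemma modular_scale_le:
  assumes "\<bar>r\<bar> \<le> 1"
  shows "\<rho> (scale (of_real r) u) \<le> \<rho> u"
proof -
  have "\<rho> (scale (of_real r) u) = \<rho> (scale (of_real \<bar>r\<bar>) u)"
    using modular_scale_unit[of "-1" "scale (of_real r) u"] by (cases "r \<ge> 0") auto
  also have "\<dots> \<le> \<bar>r\<bar> * \<rho> u"
    using modular_convex[of "\<bar>r\<bar>" "1 - \<bar>r\<bar>" u 0] assms by simp
  also have "\<dots> \<le> \<rho> u"
    using assms modular_nonneg by (simp add: mult_left_le_one_le)
  finally show ?thesis .
qed

lemma modular_space_scale:
  assumes "u \<in> modular_space scale \<rho>"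
  shows "scale k u \<in> modular_space scale \<rho>"
proof (cases "k = 0")
  case False
  \<comment> \<open>The filter \<open>at 0\<close> omits 0 itself, so \<open>k \<noteq> 0\<close>
    matters here.\<close>
  have "filterlim (\<lambda>c. c * k) (at 0) (at 0)"
    using False by (auto simp: filterlim_at eventually_at_filter intro!: tendsto_eq_intros)
  from filterlim_compose[OF _ this, of "\<lambda>c. \<rho> (scale c u)" "nhds 0"] show ?thesis
    using assms by (simp add: modular_space_def)
qed (simp add: modular_space_def)

text \<open>Convexity controls the half sum directly; rescaling by 2 then gives closure under
  addition.\<close>

lemma modular_space_midpoint:
  assumes "u \<in> modular_space scale \<rho>" "v \<in> modular_space scale \<rho>"
  shows "scale (of_real (1/2)) (u + v) \<in> modular_space scale \<rho>"
proof -
  have "\<rho> (scale c (scale (of_real (1/2)) (u + v))) \<le> 1/2 * \<rho> (scale c u) + 1/2 * \<rho> (scale c v)" for c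
    using modular_convex[of "1/2" "1/2" "scale c u" "scale c v"]
    by (simp add: scale_right_distrib mult.commute)
  moreover have "((\<lambda>c. 1/2 * \<rho> (scale c u) + 1/2 * \<rho> (scale c v)) \<longlongrightarrow> 0) (at 0)"
    using assms unfolding modular_space_def by (auto intro!: tendsto_eq_intros)
  ultimately show ?thesis
    unfolding modular_space_def mem_Collect_eq
    by (rule modular_tendsto_0[OF always_eventually[OF allI]])
qed

lemma modular_space_add:
  assumes "u \<in> modular_space scale \<rho>" "v \<in> modular_space scale \<rho>"
  shows "u + v \<in> modular_space scale \<rho>"
  using modular_space_scale[OF modular_space_midpoint[OF assms], of 2] by simp

lemma modular_space_diff:
  assumes "u \<in> modular_space scale \<rho>" "v \<in> modular_space scale \<rho>"
  shows "u - v \<in> modular_space scale \<rho>"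
  using modular_space_add[OF assms(1) modular_space_scale[OF assms(2), of "-1"]] by simp

text \<open>Membership is included because the \<Delta>2-condition bounds \<rho> only on the modular
  space.\<close>

definition modular_null :: "(nat \<Rightarrow> 'b) \<Rightarrow> bool" where
  "modular_null f \<longleftrightarrow> range f \<subseteq> modular_space scale \<rho> \<and> (\<lambda>n. \<rho> (f n)) \<longlonglongrightarrow> 0"

lemma modular_null_scale:
  assumes "modular_null f" "\<bar>r\<bar> \<le> 1"
  shows "modular_null (\<lambda>n. scale (of_real r) (f n))"
proof -
  have "(\<lambda>n. \<rho> (scale (of_real r) (f n))) \<longlonglongrightarrow> 0"
  proof (rule modular_tendsto_0)
    show "\<forall>\<^sub>F n in sequentially. \<rho> (scale (of_real r) (f n)) \<le> \<rho> (f n)"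
      using assms(2) by (simp add: modular_scale_le)
  qed (use assms(1) in \<open>simp add: modular_null_def\<close>)
  then show ?thesis using assms by (auto simp: modular_null_def intro: modular_space_scale)
qed

text \<open>The sum is twice the midpoint: the \<Delta>2-condition absorbs the factor 2 at the cost
  of \<tau>, and convexity splits the midpoint.\<close>

lemma modular_null_add:
  assumes "Delta2_condition scale \<rho>" "modular_null f" "modular_null g"
  shows "modular_null (\<lambda>n. f n + g n)"
proof -
  obtain \<tau> where \<tau>: "\<tau> > 0" "\<And>u. u \<in> modular_space scale \<rho> \<Longrightarrow> \<rho> (scale 2 u) \<le> \<tau> * \<rho> u"
    using assms(1) unfolding Delta2_condition_def by blast
  have mem: "f n \<in> modular_space scale \<rho>" "g n \<in> modular_space scale \<rho>" for n
    using assms by (auto simp: modular_null_def)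
  have "\<rho> (f n + g n) \<le> \<tau> * (1/2 * \<rho> (f n) + 1/2 * \<rho> (g n))" for n
  proof -
    have "\<rho> (f n + g n) \<le> \<tau> * \<rho> (scale (of_real (1/2)) (f n + g n))"
      using \<tau>(2)[OF modular_space_midpoint[OF mem]] by simp
    also have "\<dots> \<le> \<tau> * (1/2 * \<rho> (f n) + 1/2 * \<rho> (g n))"
      using modular_convex[of "1/2" "1/2" "f n" "g n"] \<tau>(1)
      by (intro mult_left_mono) (auto simp: scale_right_distrib)
    finally show ?thesis .
  qed
  moreover have "(\<lambda>n. \<tau> * (1/2 * \<rho> (f n) + 1/2 * \<rho> (g n))) \<longlonglongrightarrow> 0"
    using assms unfolding modular_null_def by (auto intro!: tendsto_eq_intros)
  ultimately have "(\<lambda>n. \<rho> (f n + g n)) \<longlonglongrightarrow> 0"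
    by (rule modular_tendsto_0[OF always_eventually[OF allI]])
  then show ?thesis using mem by (auto simp: modular_null_def intro: modular_space_add)
qed

lemma modular_null_diff:
  assumes "Delta2_condition scale \<rho>" "modular_null f" "modular_null g"
  shows "modular_null (\<lambda>n. f n - g n)"
  using modular_null_add[OF assms(1,2) modular_null_scale[OF assms(3), of "-1"]] by simp

lemma modular_null_const:
  assumes "modular_null (\<lambda>n. u)"
  shows "u = 0"
  using assms LIMSEQ_const_iff[of "\<rho> u" 0] by (auto simp: modular_null_def modular_eq_0_iff)

end

section \<open>The asymptotic argument far from the origin\<close>

lemma (in normed_space_over) eventually_norm_scale_ge:
  assumes "k \<noteq> 0" "x \<noteq> 0"
  shows "\<forall>\<^sub>F n in sequentially. d \<le> norm (scale (k * of_nat n) x)"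
proof -
  have "filterlim (\<lambda>n. real n * (norm k * norm x)) at_top sequentially"
    using assms by (intro filterlim_at_top_mult_tendsto_pos[OF tendsto_const])
      (auto simp: filterlim_real_sequentially)
  then show ?thesis
    by (auto simp: filterlim_at_top norm_scale norm_mult mult_ac)
qed

theorem theorem2:
  fixes scaleX :: "'k::real_normed_field \<Rightarrow> 'x::real_normed_vector \<Rightarrow> 'x"
    and scaleY :: "'k \<Rightarrow> 'y::ab_group_add \<Rightarrow> 'y"
    and \<rho> :: "'y \<Rightarrow> real"
    and E :: "'x set"
    and a b :: 'k
    and \<alpha> :: "'x \<Rightarrow> 'x \<Rightarrow> real"
    and A B d :: real
    and C :: 'y
    and \<phi> :: "'x \<Rightarrow> 'y"
  assumes "normed_space_over scaleX"
    and "convex_modular scaleY \<rho>"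
    and "Delta2_condition scaleY \<rho>"
    and "E \<noteq> {}" and "E \<noteq> {0}"
    and "\<forall>x\<in>E. - x \<in> E"
    and "\<forall>x\<in>E. \<forall>y\<in>E. x + y \<in> E \<and> x - y \<in> E"
    and "\<forall>k. \<forall>x\<in>E. scaleX k x \<in> E"
    and "a \<noteq> 0" and "b \<noteq> 0"
    and "\<forall>x\<in>E. \<forall>y\<in>E. \<alpha> x y \<ge> 0"
    and "\<forall>x\<in>E - {0}.
      (\<lambda>n::nat. \<alpha> (scaleX (inverse a * of_nat (n + 1)) x)
                   (scaleX (- inverse b * of_nat n) x)) \<longlonglongrightarrow> 0"
    and "\<forall>x\<in>E - {0}. \<forall>y\<in>E - {0}.
      (\<lambda>n::nat. \<alpha> (scaleX (of_nat n) x) (scaleX (of_nat n) y)) \<longlonglongrightarrow> 0"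
    and "\<bar>A\<bar> \<le> 1" and "\<bar>B\<bar> \<le> 1"
    and "C \<in> modular_space scaleY \<rho>"
    and "\<forall>x. \<phi> x \<in> modular_space scaleY \<rho>"
    and "d > 0"
    and "\<forall>x\<in>{z\<in>E. norm z \<ge> d}. \<forall>y\<in>{z\<in>E. norm z \<ge> d}.
      \<rho> (\<phi> (scaleX a x + scaleX b y) - scaleY (of_real A) (\<phi> x) - scaleY (of_real B) (\<phi> y) - C)
        \<le> \<alpha> x y"
  shows "\<forall>x\<in>E. \<forall>y\<in>E.
      \<phi> (scaleX a x + scaleX b y) = scaleY (of_real A) (\<phi> x) + scaleY (of_real B) (\<phi> y) + C
    \<and> scaleY (of_real (A + B)) (\<phi> 0)
        = scaleY (of_real A) (\<phi> x) + scaleY (of_real B) (\<phi> (scaleX (- (a * inverse b)) x))"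
proof -
  interpret X: normed_space_over scaleX by fact
  interpret Y: convex_modular scaleY \<rho> by fact
  have E: "X.subspace E"
    unfolding X.subspace_def
  proof (intro conjI ballI allI)
    obtain x where "x \<in> E" using assms(4) by blast
    then show "0 \<in> E" using assms(8) X.scale_zero_left by metis
  qed (use assms(7,8) in auto)
  have closed: "scaleX k u \<in> E" if "u \<in> E" for k u
    using that assms(8) by blast
  define R where
    "R x y = \<phi> (scaleX a x + scaleX b y) - scaleY (of_real A) (\<phi> x) - scaleY (of_real B) (\<phi> y) - C" for x y
  \<comment> \<open>The bound by \<alpha> holds only from norm \<open>d\<close> on, hence
    eventually; membership of the defects in the modular space holds for every index.\<close>
  have R_null: "Y.modular_null (\<lambda>n. R (s n) (t n))"
    if "\<And>n. s n \<in> E" "\<And>n. t n \<in> E" "(\<lambda>n. \<alpha> (s n) (t n)) \<longlonglongrightarrow> 0"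
      "\<forall>\<^sub>F n in sequentially. d \<le> norm (s n)" "\<forall>\<^sub>F n in sequentially. d \<le> norm (t n)" for s t
  proof -
    have "\<forall>\<^sub>F n in sequentially. \<rho> (R (s n) (t n)) \<le> \<alpha> (s n) (t n)"
      using that(4,5) by eventually_elim (use that(1,2) assms(19) in \<open>auto simp: R_def\<close>)
    then have "(\<lambda>n. \<rho> (R (s n) (t n))) \<longlonglongrightarrow> 0"
      using that(3) by (rule Y.modular_tendsto_0)
    moreover have "R (s n) (t n) \<in> modular_space scaleY \<rho>" for n
      using assms(16,17) unfolding R_def
      by (intro Y.modular_space_diff Y.modular_space_scale) auto
    ultimately show ?thesis by (auto simp: Y.modular_null_def)
  qed
  have diag: "Y.modular_null (\<lambda>n. R (scaleX (k * of_nat n) x) (scaleX (k * of_nat n) y))"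
    if "k \<noteq> 0" "x \<in> E" "y \<in> E" "x \<noteq> 0" "y \<noteq> 0" for k x y
  proof (rule R_null)
    show "(\<lambda>n. \<alpha> (scaleX (k * of_nat n) x) (scaleX (k * of_nat n) y)) \<longlonglongrightarrow> 0"
      using assms(13)[rule_format, of "scaleX k x" "scaleX k y"] that closed
      by (simp add: mult.commute)
  qed (use that closed X.eventually_norm_scale_ge in auto)
  \<comment> \<open>The first argument in \<open>S\<close> carries the factor \<open>n + 1\<close>,
    so the diagonal limit is shifted by one.\<close>
  have diag_Suc: "Y.modular_null (\<lambda>n. R (scaleX (k * of_nat (n + 1)) x) (scaleX (k * of_nat (n + 1)) y))"
    if "k \<noteq> 0" "x \<in> E" "y \<in> E" "x \<noteq> 0" "y \<noteq> 0" for k x y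
  proof -
    from diag[OF that] have "(\<lambda>n. \<rho> (R (scaleX (k * of_nat n) x) (scaleX (k * of_nat n) y))) \<longlonglongrightarrow> 0"
      by (simp add: Y.modular_null_def)
    from LIMSEQ_ignore_initial_segment[OF this, of 1] diag[OF that] show ?thesis
      unfolding Y.modular_null_def by blast
  qed
  define S where "S n z = R (scaleX (inverse a * of_nat (n + 1)) z) (scaleX (- inverse b * of_nat n) z)"
    for n :: nat and z
  have S_null: "Y.modular_null (\<lambda>n. S n z)" if z: "z \<in> E" "z \<noteq> 0" for z
    unfolding S_def
  proof (rule R_null)
    have "\<forall>\<^sub>F n in sequentially. d \<le> norm (scaleX (inverse a * of_nat n) z)"
      using X.eventually_norm_scale_ge z assms(9) by auto
    then show "\<forall>\<^sub>F n in sequentially. d \<le> norm (scaleX (inverse a * of_nat (n + 1)) z)"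
      by (rule eventually_compose_filterlim) (rule filterlim_add_const_nat_at_top)
    show "\<forall>\<^sub>F n in sequentially. d \<le> norm (scaleX (- inverse b * of_nat n) z)"
      using X.eventually_norm_scale_ge[of "- inverse b" z] z assms(10) by auto
    show "(\<lambda>n. \<alpha> (scaleX (inverse a * of_nat (n + 1)) z) (scaleX (- inverse b * of_nat n) z)) \<longlonglongrightarrow> 0"
      using z assms(12) by blast
  qed (rule closed[OF z(1)])+
  \<comment> \<open>The arguments are chosen so that \<phi> is evaluated at
    \<open>(n + 1) z - n z = z\<close>.\<close>
  have S_eq: "\<phi> z = S n z + scaleY (of_real A) (\<phi> (scaleX (inverse a * of_nat (n + 1)) z))
      + scaleY (of_real B) (\<phi> (scaleX (- inverse b * of_nat n) z)) + C" for n z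
  proof -
    have "scaleX a (scaleX (inverse a * of_nat (n + 1)) z) + scaleX b (scaleX (- inverse b * of_nat n) z) = z"
      using assms(9,10) by (simp add: distrib_left X.scale_left_distrib X.scale_right_distrib mult.assoc[symmetric])
    then show ?thesis by (simp add: S_def R_def)
  qed
  \<comment> \<open>The last condition is what \<open>S_null\<close> requires at
    \<open>a x + b y\<close>.\<close>
  have generic: "R x y = 0"
    if xy: "x \<in> E" "y \<in> E" "x \<noteq> 0" "y \<noteq> 0" "scaleX a x + scaleX b y \<noteq> 0" for x y
  proof -
    define u where "u = scaleX a x + scaleX b y"
    define p q where "p n = inverse a * of_nat (n + 1)" and "q n = - inverse b * of_nat n" for n :: nat
    define T where "T n = S n u - scaleY (of_real A) (S n x) - scaleY (of_real B) (S n y)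
        + scaleY (of_real A) (R (scaleX (p n) x) (scaleX (p n) y))
        + scaleY (of_real B) (R (scaleX (q n) x) (scaleX (q n) y))" for n
    have u: "u \<in> E" "u \<noteq> 0"
      using xy closed assms(7) by (auto simp: u_def)
    have "Y.modular_null (\<lambda>n. R (scaleX (p n) x) (scaleX (p n) y))"
      unfolding p_def using xy assms(9) by (intro diag_Suc) auto
    moreover have "Y.modular_null (\<lambda>n. R (scaleX (q n) x) (scaleX (q n) y))"
      unfolding q_def using xy assms(10) by (intro diag) auto
    ultimately have "Y.modular_null T"
      unfolding T_def
      by (intro Y.modular_null_add Y.modular_null_diff Y.modular_null_scale assms(3,14,15) S_null u xy)
    moreover have "T n = R x y" for n
    proof -
      \<comment> \<open>Points sampled for \<open>u\<close> are the same combination of those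
        sampled for \<open>x\<close> and \<open>y\<close>, so the far values regroup into defects.
        The mixed terms cancel because the scalars \<open>A\<close> and \<open>B\<close>
        commute.\<close>
      have comb: "scaleX a (scaleX k x) + scaleX b (scaleX k y) = scaleX k u" for k
        unfolding u_def by (simp only: X.scale_right_distrib X.scale_left_commute)
      note S_eq' = S_eq[of _ n, folded p_def q_def]
      have "R x y = \<phi> u - scaleY (of_real A) (\<phi> x) - scaleY (of_real B) (\<phi> y) - C"
        by (simp only: R_def u_def)
      also have "\<dots> =
          (S n u + scaleY (of_real A) (\<phi> (scaleX (p n) u)) + scaleY (of_real B) (\<phi> (scaleX (q n) u)) + C)
          - scaleY (of_real A) (S n x + scaleY (of_real A) (\<phi> (scaleX (p n) x)) + scaleY (of_real B) (\<phi> (scaleX (q n) x)) + C)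
          - scaleY (of_real B) (S n y + scaleY (of_real A) (\<phi> (scaleX (p n) y)) + scaleY (of_real B) (\<phi> (scaleX (q n) y)) + C)
          - C"
        by (simp only: S_eq'[symmetric])
      also have "\<dots> = T n"
        unfolding T_def R_def comb
        by (simp add: Y.scale_right_distrib Y.scale_right_diff_distrib mult.commute)
      finally show ?thesis by simp
    qed
    then have "T = (\<lambda>n. R x y)" by (rule ext)
    ultimately have "Y.modular_null (\<lambda>n. R x y)" by (rule subst[rotated])
    then show ?thesis by (rule Y.modular_null_const)
  qed
  have nonzero: "\<phi> (scaleX a x + scaleX b y) = scaleY (of_real A) (\<phi> x) + scaleY (of_real B) (\<phi> y) + C"
    if xy: "x \<in> E" "y \<in> E" "x \<noteq> 0" "y \<noteq> 0" for x y
  proof (cases "scaleX a x + scaleX b y = 0")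
    case False
    then show ?thesis using generic[OF xy] by (simp add: R_def algebra_simps)
  next
    case True
    define P where "P u = scaleY (of_real A) (\<phi> (scaleX (inverse a) u)) + C" for u
    define Q where "Q u = scaleY (of_real B) (\<phi> (scaleX (inverse b) u))" for u
    have PQ: "P u + Q v = \<phi> (u + v)" if "u \<in> E" "v \<in> E" "u \<noteq> 0" "v \<noteq> 0" "u + v \<noteq> 0" for u v
      using generic[of "scaleX (inverse a) u" "scaleX (inverse b) v"] that assms(9,10) closed
      by (simp add: R_def P_def Q_def algebra_simps)
    have ax: "scaleX a x \<in> E" "scaleX a x \<noteq> 0" using closed xy assms(9) by auto
    \<comment> \<open>As \<open>b y = - a x\<close>, this defect is \<phi>(0) minus
      \<open>P w + Q (- w)\<close> at \<open>w = k a x\<close>, which is constant on nonzero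
      vectors.\<close>
    have R_const: "R (scaleX k x) (scaleX k y) = R x y" if k: "k \<noteq> 0" for k
    proof -
      have "- scaleX a x = scaleX b y" using True by (metis minus_unique)
      then have "- scaleX l (scaleX a x) = scaleX b (scaleX l y)" for l
        by (metis X.scale_minus_right X.scale_left_commute)
      then have pull: "scaleX (inverse b) (- scaleX l (scaleX a x)) = scaleX l y" for l
        using assms(10) by (simp only:) simp
      have pull': "scaleX (inverse a) (scaleX l (scaleX a x)) = scaleX l x" for l
        using assms(9) by (simp add: mult.commute)
      \<comment> \<open>The redundant \<open>scaleX 1\<close> lets \<open>pull\<close> and
        \<open>pull'\<close> rewrite both sides.\<close>
      have "P (scaleX k (scaleX a x)) + Q (- scaleX k (scaleX a x))
          = P (scaleX 1 (scaleX a x)) + Q (- scaleX 1 (scaleX a x))"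
        using ax closed[OF xy(1)] k
        by (intro pexider_diagonal_constant[OF real_subspace[OF assms(1) E], of P Q \<phi>] PQ) auto
      then have "scaleY (of_real A) (\<phi> (scaleX k x)) + scaleY (of_real B) (\<phi> (scaleX k y))
          = scaleY (of_real A) (\<phi> x) + scaleY (of_real B) (\<phi> y)"
        unfolding P_def Q_def pull pull' by simp
      moreover have "scaleX a (scaleX k x) + scaleX b (scaleX k y) = 0"
        using True by (metis X.scale_left_commute X.scale_right_distrib X.scale_zero_right)
      ultimately show ?thesis
        using True by (simp add: R_def diff_diff_eq)
    qed
    \<comment> \<open>The shifted version keeps the factor \<open>n + 1\<close> nonzero at every
      index, as \<open>R_const\<close> demands.\<close>
    have "Y.modular_null (\<lambda>n. R x y)"
      using diag_Suc[of 1 x y] xy R_const[OF of_nat_neq_0] by simp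
    then have "R x y = 0" by (rule Y.modular_null_const)
    then show ?thesis by (simp add: R_def algebra_simps)
  qed
  have add: "additive (scaleY k)" for k
    by unfold_locales (rule Y.scale_right_distrib)
  have main: "\<phi> (scaleX a x + scaleX b y) = scaleY (of_real A) (\<phi> x) + scaleY (of_real B) (\<phi> y) + C"
    if "x \<in> E" "y \<in> E" for x y
    by (rule affine_equation_extend[OF assms(1) E assms(5) add add assms(9,10) nonzero that])
  show ?thesis
  proof (intro ballI conjI)
    fix x assume x: "x \<in> E"
    \<comment> \<open>This second argument makes the left side \<phi>(0); comparison with the
      equation at the origin then cancels \<open>C\<close>.\<close>
    have "scaleX a x + scaleX b (scaleX (- (a * inverse b)) x) = 0"
      using assms(10) by (simp add: field_simps)
    then have "\<phi> 0 = scaleY (of_real A) (\<phi> x) + scaleY (of_real B) (\<phi> (scaleX (- (a * inverse b)) x)) + C"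
      using main[OF x closed[OF x, of "- (a * inverse b)"]] by (simp only:)
    moreover have "\<phi> 0 = scaleY (of_real A) (\<phi> 0) + scaleY (of_real B) (\<phi> 0) + C"
      using main[of 0 0] X.subspace_0[OF E] by simp
    ultimately show "scaleY (of_real (A + B)) (\<phi> 0)
        = scaleY (of_real A) (\<phi> x) + scaleY (of_real B) (\<phi> (scaleX (- (a * inverse b)) x))"
      by (metis Y.scale_left_distrib add_right_cancel of_real_add)
  qed (rule main)
qed

end
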